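(* Let $0\le k\le n$. If $\mu\in\mathrm{VConv}_k(\mathbb{R}^n)$ satisfies $\pi_{E*}\mu=0$ for all $k$-dimensional linear subspaces $E\subset\mathbb{R}^n$, then $\mu\equiv0$.
   Context: For a finite-dimensional real vector space $V$, $\mathrm{Conv}(V,\mathbb{R})$ is the space of finite-valued convex functions $V\to\mathbb{R}$ with the topology of uniform convergence on compact subsets. A map $\mu:\mathrm{Conv}(V,\mathbb{R})\to\mathbb{R}$ is a valuation if $\mu(f)+\mu(h)=\mu(f\vee h)+\mu(f\wedge h)$ whenever $f,h$ and the pointwise maximum $f\vee h$ and minimum $f\wedge h$ belong to $\mathrm{Conv}(V,\mathbb{R})$. It is dually epi-translation invariant if $\mu(f+\ell)=\mu(f)$ for all $f\in\mathrm{Conv}(V,\mathbb{R})$ and all affine $\ell:V\to\mathbb{R}$. $\mathrm{VConv}(V)$ is the space of continuous, dually epi-translation invariant valuations on $\mathrm{Conv}(V,\mathbb{R})$, and $\mathrm{VConv}_k(V)$ is the subspace of $k$-homogeneous ones ($\mu(tf)=t^k\mu(f)$ for all $t\ge0$, $f$). For a subspace $E\subset\mathbb{R}^n$ with orthogonal projection $\pi_E:\mathbb{R}^n\to E$, $\pi_{E*}\mu\in\mathrm{VConv}(E)$ is defined by $[\pi_{E*}\mu](f):=\mu(f\circ\pi_E)$ for $f\in\mathrm{Conv}(E,\mathbb{R})$. *)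

theory Defs
  imports "HOL-Analysis.Analysis"
begin

(* A vector space V is a linear subspace of a Euclidean space, possibly UNIV.  A function V -> R
   is represented by a function on the ambient type whose values off V are irrelevant: the topology
   below does not separate functions that agree on V, so a continuous real functional on
   Conv V depends only on the restriction to V (lemma VConv_cong).  For V = UNIV there is no
   identification. *)

definition Conv :: "'a::euclidean_space set \<Rightarrow> ('a \<Rightarrow> real) set" where
  "Conv V = {f. convex_on V f}"

definition Conv_topology :: "'a::euclidean_space set \<Rightarrow> ('a \<Rightarrow> real) topology" where
  "Conv_topology V = topology (\<lambda>U. U \<subseteq> Conv V \<and>
     (\<forall>f\<in>U. \<exists>K e. compact K \<and> K \<subseteq> V \<and> e > 0 \<and>
        {g \<in> Conv V. \<forall>x\<in>K. \<bar>g x - f x\<bar> < e} \<subseteq> U))"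

lemma openin_Conv_topology:
  "openin (Conv_topology V) U \<longleftrightarrow> U \<subseteq> Conv V \<and>
     (\<forall>f\<in>U. \<exists>K e. compact K \<and> K \<subseteq> V \<and> e > 0 \<and>
        {g \<in> Conv V. \<forall>x\<in>K. \<bar>g x - f x\<bar> < e} \<subseteq> U)"
proof -
  let ?L = "\<lambda>U. U \<subseteq> Conv V \<and>
     (\<forall>f\<in>U. \<exists>K e. compact K \<and> K \<subseteq> V \<and> e > 0 \<and>
        {g \<in> Conv V. \<forall>x\<in>K. \<bar>g x - f x\<bar> < e} \<subseteq> U)"
  have "istopology ?L"
    unfolding istopology_def
  proof (intro conjI allI impI)
    fix S T assume S: "?L S" and T: "?L T"
    show "S \<inter> T \<subseteq> Conv V" using S by blast
    show "\<forall>f\<in>S \<inter> T. \<exists>K e. compact K \<and> K \<subseteq> V \<and> e > 0 \<and>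
        {g \<in> Conv V. \<forall>x\<in>K. \<bar>g x - f x\<bar> < e} \<subseteq> S \<inter> T"
    proof
      fix f assume f: "f \<in> S \<inter> T"
      obtain K e where K: "compact K" "K \<subseteq> V" "e > 0"
        "{g \<in> Conv V. \<forall>x\<in>K. \<bar>g x - f x\<bar> < e} \<subseteq> S"
        using S f by blast
      obtain L d where L: "compact L" "L \<subseteq> V" "d > 0"
        "{g \<in> Conv V. \<forall>x\<in>L. \<bar>g x - f x\<bar> < d} \<subseteq> T"
        using T f by blast
      have "{g \<in> Conv V. \<forall>x\<in>K \<union> L. \<bar>g x - f x\<bar> < min e d} \<subseteq> S \<inter> T"
        using K(4) L(4) by auto
      then show "\<exists>K e. compact K \<and> K \<subseteq> V \<and> e > 0 \<and>
          {g \<in> Conv V. \<forall>x\<in>K. \<bar>g x - f x\<bar> < e} \<subseteq> S \<inter> T"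
        using K L by (intro exI[of _ "K \<union> L"] exI[of _ "min e d"]) auto
    qed
  next
    fix \<K> assume \<K>: "\<forall>U\<in>\<K>. ?L U"
    then show "\<Union>\<K> \<subseteq> Conv V" by blast
    show "\<forall>f\<in>\<Union>\<K>. \<exists>K e. compact K \<and> K \<subseteq> V \<and> e > 0 \<and>
        {g \<in> Conv V. \<forall>x\<in>K. \<bar>g x - f x\<bar> < e} \<subseteq> \<Union>\<K>"
    proof
      fix f assume "f \<in> \<Union>\<K>"
      then obtain U where U: "U \<in> \<K>" "f \<in> U" by blast
      have "?L U" using \<K> U(1) by (rule bspec)
      from bspec[OF conjunct2[OF this] U(2)]
      obtain K e where K: "compact K" "K \<subseteq> V" "e > 0"
        "{g \<in> Conv V. \<forall>x\<in>K. \<bar>g x - f x\<bar> < e} \<subseteq> U"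
        by (elim exE conjE)
      moreover from K(4) U(1) have "{g \<in> Conv V. \<forall>x\<in>K. \<bar>g x - f x\<bar> < e} \<subseteq> \<Union>\<K>" by blast
      ultimately show "\<exists>K e. compact K \<and> K \<subseteq> V \<and> e > 0 \<and>
          {g \<in> Conv V. \<forall>x\<in>K. \<bar>g x - f x\<bar> < e} \<subseteq> \<Union>\<K>" by blast
    qed
  qed
  then show ?thesis by (simp add: Conv_topology_def)
qed

lemma topspace_Conv_topology: "topspace (Conv_topology V) = Conv V"
proof
  show "topspace (Conv_topology V) \<subseteq> Conv V"
    using openin_Conv_topology openin_topspace by blast
  have "openin (Conv_topology V) (Conv V)"
    unfolding openin_Conv_topology by (auto intro!: exI[of _ "{}"] exI[of _ "1::real"])
  then show "Conv V \<subseteq> topspace (Conv_topology V)" by (rule openin_subset)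
qed

definition valuation_on_Conv :: "'a::euclidean_space set \<Rightarrow> (('a \<Rightarrow> real) \<Rightarrow> real) \<Rightarrow> bool" where
  "valuation_on_Conv V \<mu> \<longleftrightarrow>
     (\<forall>f h. f \<in> Conv V \<and> h \<in> Conv V \<and>
        (\<lambda>x. max (f x) (h x)) \<in> Conv V \<and> (\<lambda>x. min (f x) (h x)) \<in> Conv V \<longrightarrow>
        \<mu> f + \<mu> h = \<mu> (\<lambda>x. max (f x) (h x)) + \<mu> (\<lambda>x. min (f x) (h x)))"

(* Every affine function on the subspace V is the restriction of some \<phi> x + c with \<phi> linear on
   the ambient space. *)
definition dually_epi_translation_invariant ::
    "'a::euclidean_space set \<Rightarrow> (('a \<Rightarrow> real) \<Rightarrow> real) \<Rightarrow> bool" where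
  "dually_epi_translation_invariant V \<mu> \<longleftrightarrow>
     (\<forall>f \<phi> c. f \<in> Conv V \<and> linear \<phi> \<longrightarrow> \<mu> (\<lambda>x. f x + (\<phi> x + c)) = \<mu> f)"

definition VConv :: "'a::euclidean_space set \<Rightarrow> (('a \<Rightarrow> real) \<Rightarrow> real) set" where
  "VConv V = {\<mu>. continuous_map (Conv_topology V) euclideanreal \<mu> \<and>
     valuation_on_Conv V \<mu> \<and> dually_epi_translation_invariant V \<mu>}"

definition VConv_hom :: "'a::euclidean_space set \<Rightarrow> nat \<Rightarrow> (('a \<Rightarrow> real) \<Rightarrow> real) set" where
  "VConv_hom V k = {\<mu> \<in> VConv V. \<forall>t\<ge>0. \<forall>f\<in>Conv V. \<mu> (\<lambda>x. t * f x) = t ^ k * \<mu> f}"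

definition orth_proj :: "'a::euclidean_space set \<Rightarrow> 'a \<Rightarrow> 'a" where
  "orth_proj E x = (THE y. y \<in> E \<and> (\<forall>z\<in>E. orthogonal (x - y) z))"

definition pushforward_proj ::
    "'a::euclidean_space set \<Rightarrow> (('a \<Rightarrow> real) \<Rightarrow> real) \<Rightarrow> ('a \<Rightarrow> real) \<Rightarrow> real" where
  "pushforward_proj E \<mu> f = \<mu> (f \<circ> orth_proj E)"

lemma VConv_cong:
  assumes "\<mu> \<in> VConv V" "f \<in> Conv V" "g \<in> Conv V" "\<And>x. x \<in> V \<Longrightarrow> f x = g x"
  shows "\<mu> f = \<mu> g"
proof (rule ccontr)
  assume ne: "\<mu> f \<noteq> \<mu> g"
  let ?U = "{h \<in> Conv V. \<mu> h \<in> - {\<mu> g}}"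
  have "openin (Conv_topology V) {h \<in> topspace (Conv_topology V). \<mu> h \<in> - {\<mu> g}}"
    using assms(1) by (intro openin_continuous_map_preimage[where Y = euclideanreal])
      (auto simp: VConv_def)
  then have "openin (Conv_topology V) ?U" by (simp add: topspace_Conv_topology)
  moreover have "f \<in> ?U" using ne assms by simp
  ultimately obtain K e where K: "K \<subseteq> V" "e > 0"
      "{h \<in> Conv V. \<forall>x\<in>K. \<bar>h x - f x\<bar> < e} \<subseteq> ?U"
    unfolding openin_Conv_topology by blast
  have "g \<in> {h \<in> Conv V. \<forall>x\<in>K. \<bar>h x - f x\<bar> < e}"
    using assms(3,4) K(1,2) by (auto simp: subset_iff)
  then show False using K(3) by blast
qed

lemma orth_proj_unique:
  assumes "subspace E" "y \<in> E" "\<And>z. z \<in> E \<Longrightarrow> orthogonal (x - y) z"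
  shows "orth_proj E x = y"
  unfolding orth_proj_def
proof (rule the_equality)
  show "y \<in> E \<and> (\<forall>z\<in>E. orthogonal (x - y) z)" using assms by blast
  fix w assume w: "w \<in> E \<and> (\<forall>z\<in>E. orthogonal (x - w) z)"
  then have d: "w - y \<in> E" using assms subspace_diff by blast
  have "(w - y) \<bullet> (w - y) = (x - y) \<bullet> (w - y) - (x - w) \<bullet> (w - y)"
    by (simp add: inner_diff_left)
  also have "\<dots> = 0" using d w assms(3) by (simp add: orthogonal_def)
  finally show "w = y" by simp
qed

lemma orth_proj:
  assumes "subspace E"
  shows "orth_proj E x \<in> E" "z \<in> E \<Longrightarrow> orthogonal (x - orth_proj E x) z"
proof -
  obtain y w where y: "y \<in> span E" "\<And>z. z \<in> span E \<Longrightarrow> orthogonal w z" "x = y + w"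
    using orthogonal_subspace_decomp_exists by blast
  moreover have "span E = E" using assms by (simp add: span_eq_iff)
  ultimately have "orth_proj E x = y" "y \<in> E" "\<And>z. z \<in> E \<Longrightarrow> orthogonal (x - y) z"
    using assms by (auto intro!: orth_proj_unique)
  then show "orth_proj E x \<in> E" "z \<in> E \<Longrightarrow> orthogonal (x - orth_proj E x) z" by auto
qed

lemma linear_orth_proj:
  assumes "subspace E" shows "linear (orth_proj E)"
proof (rule linearI)
  fix x y :: 'a and c :: real
  show "orth_proj E (x + y) = orth_proj E x + orth_proj E y"
    using orth_proj(2)[OF assms, of _ x] orth_proj(2)[OF assms, of _ y]
    by (intro orth_proj_unique assms subspace_add orth_proj)
       (auto simp: orthogonal_def inner_diff_left inner_add_left)
  show "orth_proj E (c *\<^sub>R x) = c *\<^sub>R orth_proj E x"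
    using orth_proj(2)[OF assms, of _ x]
    by (intro orth_proj_unique assms subspace_scale orth_proj)
       (auto simp: orthogonal_def inner_diff_left)
qed

lemma Conv_comp_orth_proj:
  assumes "subspace E" "f \<in> Conv E"
  shows "f \<circ> orth_proj E \<in> Conv UNIV"
  using assms orth_proj(1)[OF assms(1)]
  by (auto simp: Conv_def convex_on_def linear_add[OF linear_orth_proj] linear_scale[OF linear_orth_proj])

lemma pushforward_proj_VConv:
  assumes E: "subspace E" and \<mu>: "\<mu> \<in> VConv UNIV"
  shows "pushforward_proj E \<mu> \<in> VConv E"
proof -
  let ?P = "orth_proj E"
  note c = Conv_comp_orth_proj[OF E]
  have "continuous_map (Conv_topology E) (Conv_topology UNIV) (\<lambda>f. f \<circ> ?P)"
    unfolding continuous_map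
  proof (intro conjI allI impI)
    show "(\<lambda>f. f \<circ> ?P) ` topspace (Conv_topology E) \<subseteq> topspace (Conv_topology UNIV)"
      using c by (auto simp: topspace_Conv_topology)
    fix U :: "('a \<Rightarrow> real) set" assume U: "openin (Conv_topology UNIV) U"
    show "openin (Conv_topology E) {f \<in> topspace (Conv_topology E). f \<circ> ?P \<in> U}"
      unfolding openin_Conv_topology topspace_Conv_topology
    proof (intro conjI ballI)
      show "{f \<in> Conv E. f \<circ> ?P \<in> U} \<subseteq> Conv E" by blast
      fix f assume "f \<in> {f \<in> Conv E. f \<circ> ?P \<in> U}"
      then obtain K e where K: "compact K" "e > 0"
        "{g \<in> Conv UNIV. \<forall>x\<in>K. \<bar>g x - (f \<circ> ?P) x\<bar> < e} \<subseteq> U"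
        using U unfolding openin_Conv_topology by blast
      have "compact (?P ` K)"
        using K(1) linear_orth_proj[OF E]
        by (intro compact_continuous_image linear_continuous_on)
           (simp_all add: linear_conv_bounded_linear)
      moreover have "?P ` K \<subseteq> E" using orth_proj(1)[OF E] by blast
      moreover have "{g \<in> Conv E. \<forall>x\<in>?P ` K. \<bar>g x - f x\<bar> < e} \<subseteq> {f \<in> Conv E. f \<circ> ?P \<in> U}"
        using K(3) c by auto
      ultimately show "\<exists>K e. compact K \<and> K \<subseteq> E \<and> e > 0 \<and>
          {g \<in> Conv E. \<forall>x\<in>K. \<bar>g x - f x\<bar> < e} \<subseteq> {f \<in> Conv E. f \<circ> ?P \<in> U}"
        using K(2) by blast
    qed
  qed
  then have "continuous_map (Conv_topology E) euclideanreal (\<mu> \<circ> (\<lambda>f. f \<circ> ?P))"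
    using \<mu> by (intro continuous_map_compose) (auto simp: VConv_def)
  moreover have "\<mu> \<circ> (\<lambda>f. f \<circ> ?P) = pushforward_proj E \<mu>"
    by (auto simp: pushforward_proj_def fun_eq_iff)
  moreover have "valuation_on_Conv E (pushforward_proj E \<mu>)"
    unfolding valuation_on_Conv_def pushforward_proj_def
  proof (intro allI impI, elim conjE)
    fix f h
    assume "f \<in> Conv E" "h \<in> Conv E" "(\<lambda>x. max (f x) (h x)) \<in> Conv E"
      "(\<lambda>x. min (f x) (h x)) \<in> Conv E"
    then have "f \<circ> ?P \<in> Conv UNIV" "h \<circ> ?P \<in> Conv UNIV"
      "(\<lambda>x. max ((f \<circ> ?P) x) ((h \<circ> ?P) x)) \<in> Conv UNIV"
      "(\<lambda>x. min ((f \<circ> ?P) x) ((h \<circ> ?P) x)) \<in> Conv UNIV"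
      by (auto dest: c simp: o_def)
    moreover have "valuation_on_Conv UNIV \<mu>" using \<mu> by (simp add: VConv_def)
    ultimately have "\<mu> (f \<circ> ?P) + \<mu> (h \<circ> ?P)
      = \<mu> (\<lambda>x. max ((f \<circ> ?P) x) ((h \<circ> ?P) x)) + \<mu> (\<lambda>x. min ((f \<circ> ?P) x) ((h \<circ> ?P) x))"
      unfolding valuation_on_Conv_def by meson
    then show "\<mu> (f \<circ> ?P) + \<mu> (h \<circ> ?P)
      = \<mu> ((\<lambda>x. max (f x) (h x)) \<circ> ?P) + \<mu> ((\<lambda>x. min (f x) (h x)) \<circ> ?P)"
      by (simp add: o_def)
  qed
  moreover have "dually_epi_translation_invariant E (pushforward_proj E \<mu>)"
    unfolding dually_epi_translation_invariant_def pushforward_proj_def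
  proof (intro allI impI, elim conjE)
    fix f \<phi> c assume f: "f \<in> Conv E" and \<phi>: "linear (\<phi> :: 'a \<Rightarrow> real)"
    have "linear (\<phi> \<circ> ?P)" using \<phi> linear_orth_proj[OF E] by (rule linear_compose[rotated])
    then have "\<mu> (\<lambda>x. (f \<circ> ?P) x + ((\<phi> \<circ> ?P) x + c)) = \<mu> (f \<circ> ?P)"
      using \<mu> Conv_comp_orth_proj[OF E f]
      unfolding VConv_def dually_epi_translation_invariant_def by blast
    then show "\<mu> ((\<lambda>x. f x + (\<phi> x + c)) \<circ> ?P) = \<mu> (f \<circ> ?P)" by (simp add: o_def)
  qed
  ultimately show ?thesis by (simp add: VConv_def)
qed

end

theory Submission
  imports Defs
begin

text \<open>For an affine function \<open>\<l>\<close> with positive part \<open>\<l>\<^sub>+\<close>, the valuation property and affine invariance make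
  \<open>s \<mapsto> \<mu> (f + s \<l>\<^sub>+)\<close> affine. Hence the difference \<open>f \<mapsto> \<mu> (f + \<l>\<^sub>+) - \<mu> f\<close> is again a continuous
  invariant valuation, homogeneous of degree \<open>k - 1\<close>, and it vanishes on functions of \<open>k - 1\<close>
  directions; by induction on \<open>k\<close> it is zero. So \<open>\<mu>\<close> does not change when \<open>\<l>\<^sub>+\<close> is added, and by
  continuity not when any convex function of one linear form is added, in particular an exponential
  of an affine function. It follows that \<open>\<mu> f = \<mu> 0\<close> for every convex \<open>f\<close> that is a signed
  combination of such exponentials, by moving the negative terms to the other side. These \<open>f\<close>
  are dense: a maximum of affine functions is approximated by \<open>ln (\<Sum>i. exp (t \<l>\<^sub>i)) / t\<close>, and
  replacing \<open>ln\<close> by an odd-order Taylor polynomial keeps global convexity.\<close>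

section \<open>Finite convex functions and continuity of valuations on them\<close>

lemma Conv_UNIV_iff: "f \<in> Conv UNIV \<longleftrightarrow> convex_on UNIV f"
  by (simp add: Conv_def)

lemma Conv_add: "f \<in> Conv V \<Longrightarrow> g \<in> Conv V \<Longrightarrow> (\<lambda>x. f x + g x) \<in> Conv V"
  by (auto simp: Conv_def)

lemma Conv_cmult: "f \<in> Conv V \<Longrightarrow> 0 \<le> c \<Longrightarrow> (\<lambda>x. c * f x) \<in> Conv V"
  by (auto simp: Conv_def)

lemma Conv_continuous: "f \<in> Conv UNIV \<Longrightarrow> continuous_on A f"
  by (metis Conv_UNIV_iff convex_on_continuous continuous_on_subset open_UNIV subset_UNIV)

lemma Conv_ridge:
  assumes "convex_on UNIV (g :: real \<Rightarrow> real)"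
  shows "(\<lambda>x. g (y \<bullet> x)) \<in> Conv UNIV"
  using assms unfolding Conv_UNIV_iff convex_on_def by (auto simp: inner_add_right)

lemma Conv_affine: "(\<lambda>x. y \<bullet> x + c) \<in> Conv UNIV"
  using Conv_ridge[of "\<lambda>s. s + c" y] by (simp add: convex_on_add convex_on_const convex_on_ident)

lemma convex_on_hinge: "convex_on UNIV (\<lambda>s::real. max (s + c) 0)"
proof (intro convex_onI)
  fix t x y :: real assume t: "0 < t" "t < 1"
  have "(1 - t) * (x + c) \<le> (1 - t) * max (x + c) 0" "t * (y + c) \<le> t * max (y + c) 0"
    using t by (auto intro!: mult_left_mono)
  moreover have "0 \<le> (1 - t) * max (x + c) 0" "0 \<le> t * max (y + c) 0"
    using t by auto
  moreover have "((1 - t) *\<^sub>R x + t *\<^sub>R y) + c = (1 - t) * (x + c) + t * (y + c)"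
    by (simp add: algebra_simps)
  ultimately show "max ((1 - t) *\<^sub>R x + t *\<^sub>R y + c) 0
      \<le> (1 - t) * max (x + c) 0 + t * max (y + c) 0"
    by linarith
qed simp

lemma VConv_near:
  assumes "\<mu> \<in> VConv V" "f \<in> Conv V" "e > 0"
  obtains K d where "compact K" "d > 0"
    "\<And>g. g \<in> Conv V \<Longrightarrow> (\<And>x. x \<in> K \<Longrightarrow> \<bar>g x - f x\<bar> < d) \<Longrightarrow> \<bar>\<mu> g - \<mu> f\<bar> < e"
proof -
  let ?U = "{h \<in> Conv V. \<mu> h \<in> ball (\<mu> f) e}"
  have "openin (Conv_topology V) {h \<in> topspace (Conv_topology V). \<mu> h \<in> ball (\<mu> f) e}"
    using assms(1) by (intro openin_continuous_map_preimage[where Y = euclideanreal])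
      (auto simp: VConv_def)
  then have "openin (Conv_topology V) ?U" by (simp add: topspace_Conv_topology)
  moreover have "f \<in> ?U" using assms by simp
  ultimately obtain K d where K: "compact K" "d > 0"
      "{h \<in> Conv V. \<forall>x\<in>K. \<bar>h x - f x\<bar> < d} \<subseteq> ?U"
    unfolding openin_Conv_topology by blast
  show thesis
  proof (rule that[OF K(1,2)])
    fix g assume "g \<in> Conv V" "\<And>x. x \<in> K \<Longrightarrow> \<bar>g x - f x\<bar> < d"
    with K(3) have "\<mu> g \<in> ball (\<mu> f) e" by blast
    then show "\<bar>\<mu> g - \<mu> f\<bar> < e" by (simp add: dist_real_def abs_minus_commute)
  qed
qed

text \<open>This is the form in which continuity is used: a value that \<open>\<mu>\<close> takes on
  approximants passes to the limit. Balls suffice because every compact set lies in one.\<close>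

lemma VConv_limit_unique:
  assumes \<mu>: "\<mu> \<in> VConv UNIV" and f: "f \<in> Conv UNIV"
    and ap: "\<And>R e. R > 0 \<Longrightarrow> e > 0 \<Longrightarrow>
      \<exists>g\<in>Conv UNIV. (\<forall>x\<in>cball 0 R. \<bar>g x - f x\<bar> < e) \<and> \<mu> g = c"
  shows "\<mu> f = c"
proof (rule ccontr)
  assume "\<mu> f \<noteq> c"
  then have "\<bar>c - \<mu> f\<bar> > 0" by simp
  then obtain K d where K: "compact K" "d > 0"
    "\<And>g. g \<in> Conv UNIV \<Longrightarrow> (\<And>x. x \<in> K \<Longrightarrow> \<bar>g x - f x\<bar> < d) \<Longrightarrow> \<bar>\<mu> g - \<mu> f\<bar> < \<bar>c - \<mu> f\<bar>"
    using VConv_near[OF \<mu> f] by blast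
  obtain R where R: "R > 0" "K \<subseteq> cball 0 R"
    using compact_imp_bounded[OF K(1)] by (metis bounded_pos mem_cball_0 subsetI)
  obtain g where "g \<in> Conv UNIV" "\<forall>x\<in>cball 0 R. \<bar>g x - f x\<bar> < d" "\<mu> g = c"
    using ap[OF R(1) K(2)] by blast
  then show False using K(3)[of g] R(2) by blast
qed

lemma VConv_affine_invariant:
  assumes "\<mu> \<in> VConv V" "f \<in> Conv V"
  shows "\<mu> (\<lambda>x. f x + (y \<bullet> x + c)) = \<mu> f"
proof -
  have "linear (\<lambda>x. y \<bullet> x)" by (simp add: linear_conv_bounded_linear bounded_linear_inner_right)
  then show ?thesis
    using assms unfolding VConv_def dually_epi_translation_invariant_def by blast
qed

lemma VConv_valuation:
  assumes "\<mu> \<in> VConv V" "f \<in> Conv V" "h \<in> Conv V"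
    "(\<lambda>x. max (f x) (h x)) \<in> Conv V" "(\<lambda>x. min (f x) (h x)) \<in> Conv V"
  shows "\<mu> f + \<mu> h = \<mu> (\<lambda>x. max (f x) (h x)) + \<mu> (\<lambda>x. min (f x) (h x))"
  using assms unfolding VConv_def valuation_on_Conv_def by blast

section \<open>Difference valuations and hinges\<close>

text \<open>Adding a fixed \<open>g\<close> is continuous and commutes with maxima, minima and
  affine shifts. This keeps the induction on the degree inside \<open>VConv\<close>.\<close>

lemma VConv_difference:
  assumes \<mu>: "\<mu> \<in> VConv V" and g: "g \<in> Conv V"
  shows "(\<lambda>f. \<mu> (\<lambda>x. f x + g x) - \<mu> f) \<in> VConv V"
proof -
  have "continuous_map (Conv_topology V) (Conv_topology V) (\<lambda>f x. f x + g x)"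
    unfolding continuous_map openin_Conv_topology topspace_Conv_topology
  proof (intro conjI allI impI ballI)
    show "(\<lambda>f x. f x + g x) ` Conv V \<subseteq> Conv V" using g by (auto intro: Conv_add)
    fix U assume U: "U \<subseteq> Conv V \<and> (\<forall>f\<in>U. \<exists>K e. compact K \<and> K \<subseteq> V \<and> e > 0 \<and>
        {g \<in> Conv V. \<forall>x\<in>K. \<bar>g x - f x\<bar> < e} \<subseteq> U)"
    show "{f \<in> Conv V. (\<lambda>x. f x + g x) \<in> U} \<subseteq> Conv V" by blast
    fix f assume "f \<in> {f \<in> Conv V. (\<lambda>x. f x + g x) \<in> U}"
    then obtain K e where K: "compact K" "K \<subseteq> V" "e > 0"
      "{h \<in> Conv V. \<forall>x\<in>K. \<bar>h x - (f x + g x)\<bar> < e} \<subseteq> U"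
      using conjunct2[OF U] by auto
    have "(\<lambda>x. h x + g x) \<in> U" if "h \<in> Conv V" "\<forall>x\<in>K. \<bar>h x - f x\<bar> < e" for h
      using that by (intro subsetD[OF K(4)]) (simp add: Conv_add[OF that(1) g])
    then have "{h \<in> Conv V. \<forall>x\<in>K. \<bar>h x - f x\<bar> < e} \<subseteq> {f \<in> Conv V. (\<lambda>x. f x + g x) \<in> U}"
      by auto
    with K(1-3) show "\<exists>K e. compact K \<and> K \<subseteq> V \<and> e > 0 \<and>
        {h \<in> Conv V. \<forall>x\<in>K. \<bar>h x - f x\<bar> < e} \<subseteq> {f \<in> Conv V. (\<lambda>x. f x + g x) \<in> U}"
      by (intro exI conjI)
  qed
  then have "continuous_map (Conv_topology V) euclideanreal (\<mu> \<circ> (\<lambda>f x. f x + g x))"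
    using \<mu> by (intro continuous_map_compose) (auto simp: VConv_def)
  then have "continuous_map (Conv_topology V) euclideanreal (\<lambda>f. \<mu> (\<lambda>x. f x + g x) - \<mu> f)"
    using \<mu> by (intro continuous_map_diff) (auto simp: VConv_def o_def)
  moreover have "valuation_on_Conv V (\<lambda>f. \<mu> (\<lambda>x. f x + g x) - \<mu> f)"
    unfolding valuation_on_Conv_def
  proof (intro allI impI, elim conjE)
    fix f h assume fh: "f \<in> Conv V" "h \<in> Conv V" "(\<lambda>x. max (f x) (h x)) \<in> Conv V"
      "(\<lambda>x. min (f x) (h x)) \<in> Conv V"
    have eq: "max (f x + g x) (h x + g x) = max (f x) (h x) + g x"
      "min (f x + g x) (h x + g x) = min (f x) (h x) + g x" for x by auto
    show "\<mu> (\<lambda>x. f x + g x) - \<mu> f + (\<mu> (\<lambda>x. h x + g x) - \<mu> h) =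
       \<mu> (\<lambda>x. max (f x) (h x) + g x) - \<mu> (\<lambda>x. max (f x) (h x)) +
       (\<mu> (\<lambda>x. min (f x) (h x) + g x) - \<mu> (\<lambda>x. min (f x) (h x)))"
      using VConv_valuation[OF \<mu> fh] VConv_valuation[OF \<mu>, of "\<lambda>x. f x + g x" "\<lambda>x. h x + g x"]
        fh[THEN Conv_add[OF _ g]]
      by (simp add: eq)
  qed
  moreover have "dually_epi_translation_invariant V (\<lambda>f. \<mu> (\<lambda>x. f x + g x) - \<mu> f)"
    unfolding dually_epi_translation_invariant_def
  proof (intro allI impI, elim conjE)
    fix f \<phi> c assume f: "f \<in> Conv V" and \<phi>: "linear (\<phi> :: 'a \<Rightarrow> real)"
    have inv: "\<mu> (\<lambda>x. f x + (\<phi> x + c)) = \<mu> f" if "f \<in> Conv V" for f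
      using \<mu> that \<phi> unfolding VConv_def dually_epi_translation_invariant_def by blast
    show "\<mu> (\<lambda>x. f x + (\<phi> x + c) + g x) - \<mu> (\<lambda>x. f x + (\<phi> x + c)) = \<mu> (\<lambda>x. f x + g x) - \<mu> f"
      using inv[OF f] inv[OF Conv_add[OF f g]] by (simp add: algebra_simps)
  qed
  ultimately show ?thesis by (simp add: VConv_def)
qed

text \<open>Adding \<open>\<l>\<^sub>+\<close> for an affine \<open>\<l>\<close> is the dual of adding a segment to a convex body; the maximum of
  \<open>f + \<l>\<^sub>+\<close> and \<open>f + \<l> + \<l>\<^sub>+\<close> is \<open>f + 2\<l>\<^sub>+\<close>, and their minimum is \<open>f + \<l>\<close>.\<close>

lemma VConv_add_hinge_twice:
  fixes y :: "'a::euclidean_space" and c :: real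
  assumes \<mu>: "\<mu> \<in> VConv UNIV" and f: "f \<in> Conv UNIV"
  defines "p \<equiv> \<lambda>x. max (y \<bullet> x + c) 0"
  shows "\<mu> (\<lambda>x. f x + 2 * p x) - \<mu> (\<lambda>x. f x + p x) = \<mu> (\<lambda>x. f x + p x) - \<mu> f"
proof -
  have p: "p \<in> Conv UNIV" unfolding p_def by (rule Conv_ridge[OF convex_on_hinge])
  have cv1: "(\<lambda>x. f x + p x) \<in> Conv UNIV" by (rule Conv_add[OF f p])
  have cv2: "(\<lambda>x. f x + p x + (y \<bullet> x + c)) \<in> Conv UNIV" by (rule Conv_add[OF cv1 Conv_affine])
  have cv3: "(\<lambda>x. f x + 2 * p x) \<in> Conv UNIV" by (rule Conv_add[OF f Conv_cmult[OF p]]) simp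
  have cv4: "(\<lambda>x. f x + (y \<bullet> x + c)) \<in> Conv UNIV" by (rule Conv_add[OF f Conv_affine])
  have eq: "(\<lambda>x. max (f x + p x) (f x + p x + (y \<bullet> x + c))) = (\<lambda>x. f x + 2 * p x)"
    "(\<lambda>x. min (f x + p x) (f x + p x + (y \<bullet> x + c))) = (\<lambda>x. f x + (y \<bullet> x + c))"
    by (auto simp: p_def max_def min_def)
  have "\<mu> (\<lambda>x. f x + p x) + \<mu> (\<lambda>x. f x + p x + (y \<bullet> x + c))
     = \<mu> (\<lambda>x. f x + 2 * p x) + \<mu> (\<lambda>x. f x + (y \<bullet> x + c))"
    using VConv_valuation[OF \<mu> cv1 cv2] cv3 cv4 unfolding eq by blast
  then show ?thesis
    unfolding VConv_affine_invariant[OF \<mu> f] VConv_affine_invariant[OF \<mu> cv1] by simp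
qed

section \<open>From hinges to convex functions of one linear form\<close>

text \<open>Interpolate \<open>g\<close> linearly at equally spaced nodes. By convexity the slope
  jumps at the nodes are nonnegative, and they are the coefficients of the hinges.\<close>

lemma convex_piecewise_linear_approx:
  fixes g :: "real \<Rightarrow> real"
  assumes g: "convex_on UNIV g" and "e > 0" "R > 0"
  shows "\<exists>\<alpha> \<beta> (\<sigma> :: nat \<Rightarrow> real) a n. (\<forall>j. \<sigma> j \<ge> 0) \<and>
    (\<forall>s\<in>{-R..R}. \<bar>\<alpha> + \<beta> * s + (\<Sum>j<n. \<sigma> j * max (s - a j) 0) - g s\<bar> < e)"
proof -
  have "continuous_on {-R..R} g"
    using g by (metis convex_on_continuous continuous_on_subset open_UNIV subset_UNIV)
  then have "uniformly_continuous_on {-R..R} g" by (simp add: compact_uniformly_continuous)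
  then obtain d where d: "d > 0"
    "\<And>s t. s \<in> {-R..R} \<Longrightarrow> t \<in> {-R..R} \<Longrightarrow> \<bar>t - s\<bar> < d \<Longrightarrow> \<bar>g t - g s\<bar> < e"
    unfolding uniformly_continuous_on_def dist_real_def using \<open>e > 0\<close> by blast
  \<comment> \<open>\<open>Suc n\<close> cells of width \<open>h\<close> fill the interval, and
    \<open>n\<close> is large enough for \<open>h < d\<close>.\<close>
  obtain n where n: "2 * R / d < real (Suc n)"
    by (metis reals_Archimedean2 lessI less_trans of_nat_less_iff)
  define h where "h = 2 * R / Suc n"
  have h: "h > 0" "h < d" using \<open>R > 0\<close> \<open>d > 0\<close> n by (auto simp: h_def field_simps)
  define a where "a j = - R + real j * h" for j
  define m where "m j = (g (a (Suc j)) - g (a j)) / h" for j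
  have a_Suc: "a (Suc j) = a j + h" for j by (simp add: a_def algebra_simps)
  have aR: "a j \<in> {-R..R}" if "j \<le> Suc n" for j
  proof -
    have "real j * h \<le> real (Suc n) * h" using that h by (intro mult_right_mono) auto
    also have "\<dots> = 2 * R" by (simp add: h_def)
    finally show ?thesis using h by (auto simp: a_def)
  qed
  \<comment> \<open>At equally spaced nodes, increasing slopes amount to midpoint convexity.\<close>
  have mono: "m j \<le> m (Suc j)" for j
  proof -
    have "g ((1 - 1/2) *\<^sub>R a j + (1/2) *\<^sub>R a (Suc (Suc j)))
        \<le> (1 - 1/2) * g (a j) + (1/2) * g (a (Suc (Suc j)))"
      using convex_onD[OF g, of "1/2"] by simp
    also have "(1 - 1/2) *\<^sub>R a j + (1/2) *\<^sub>R a (Suc (Suc j)) = a (Suc j)"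
      by (simp add: a_Suc algebra_simps)
    finally show ?thesis using h unfolding m_def by (intro divide_right_mono) auto
  qed
  \<comment> \<open>\<open>G i\<close> has hinges only at \<open>a 1, ..., a i\<close>, so from
    \<open>a i\<close> onward it follows the chord of cell \<open>i\<close>.\<close>
  define G where "G i s = g (a 0) + m 0 * (s - a 0)
      + (\<Sum>j<i. (m (Suc j) - m j) * max (s - a (Suc j)) 0)" for i s
  have right: "G i s = g (a i) + m i * (s - a i)" if "a i \<le> s" for i s
    using that
  proof (induction i)
    case (Suc i)
    have "G i s = g (a i) + m i * (s - a i)" using Suc h by (simp add: a_Suc)
    moreover have "m i * h = g (a (Suc i)) - g (a i)" using h by (simp add: m_def)
    ultimately show ?case using Suc.prems by (simp add: G_def a_Suc algebra_simps)
  qed (simp add: G_def)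
  have cell: "\<bar>g (a i) + m i * (s - a i) - g s\<bar> < e"
    if "i \<le> n" "a i \<le> s" "s \<le> a (Suc i)" for i s
  proof -
    \<comment> \<open>The relative position of \<open>s\<close> in its cell: the chord mixes the two
      end values with weights \<open>1 - w\<close> and \<open>w\<close>, and both lie within
      \<open>e\<close> of \<open>g s\<close>.\<close>
    define w where "w = (s - a i) / h"
    have w: "0 \<le> w" "w \<le> 1" using that h by (auto simp: w_def a_Suc)
    have sR: "s \<in> {-R..R}" using aR[of i] aR[of "Suc i"] that by auto
    have "\<bar>g (a i) - g s\<bar> < e" "\<bar>g (a (Suc i)) - g s\<bar> < e"
      using that h aR[of i] aR[of "Suc i"] sR by (auto intro!: d(2) simp: a_Suc)
    then have *: "(1 - w) * \<bar>g (a i) - g s\<bar> + w * \<bar>g (a (Suc i)) - g s\<bar> < e"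
      using w by (intro convex_bound_lt) auto
    have "g (a i) + m i * (s - a i) - g s = (1 - w) * (g (a i) - g s) + w * (g (a (Suc i)) - g s)"
      using h by (simp add: m_def w_def field_simps)
    also have "\<bar>\<dots>\<bar> \<le> (1 - w) * \<bar>g (a i) - g s\<bar> + w * \<bar>g (a (Suc i)) - g s\<bar>"
      using w by (intro order_trans[OF abs_triangle_ineq]) (simp add: abs_mult)
    finally show ?thesis using * by linarith
  qed
  have err: "\<bar>G i s - g s\<bar> < e" if "i \<le> n" "a 0 \<le> s" "s \<le> a (Suc i)" for i s
    using that
  proof (induction i)
    case 0
    then show ?case using right[of 0 s] cell[of 0 s] by simp
  next
    case (Suc i)
    show ?case
    proof (cases "s \<le> a (Suc i)")
      case True
      then have "G (Suc i) s = G i s" by (simp add: G_def)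
      then show ?thesis using Suc True by simp
    next
      case False
      then show ?thesis using Suc.prems right[of "Suc i" s] cell[of "Suc i" s] by simp
    qed
  qed
  have "a 0 = - R" "a (Suc n) = R" by (simp_all add: a_def h_def)
  then have "\<bar>(g (a 0) - m 0 * a 0) + m 0 * s + (\<Sum>j<n. (m (Suc j) - m j) * max (s - a (Suc j)) 0) - g s\<bar> < e"
    if "s \<in> {-R..R}" for s
    using err[of n s] that by (simp add: G_def algebra_simps)
  then show ?thesis using mono
    by (intro exI[of _ "g (a 0) - m 0 * a 0"] exI[of _ "m 0"] exI[of _ "\<lambda>j. m (Suc j) - m j"]
        exI[of _ "\<lambda>j. a (Suc j)"] exI[of _ n]) simp
qed

text \<open>A nonnegative coefficient moves inside the hinge, which is then again the positive part
  of an affine function. Convexity is carried along so that the next hinge can be added.\<close>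

lemma hinge_sum_invariant:
  assumes hinge: "\<And>f y c. f \<in> Conv UNIV \<Longrightarrow> \<mu> (\<lambda>x. f x + max (y \<bullet> x + c) 0) = \<mu> f"
    and f: "f \<in> Conv UNIV" and \<sigma>: "\<And>j. \<sigma> j \<ge> (0::real)"
  shows "(\<lambda>x. f x + (\<Sum>j<(n::nat). \<sigma> j * max (y \<bullet> x - a j) 0)) \<in> Conv UNIV \<and>
    \<mu> (\<lambda>x. f x + (\<Sum>j<n. \<sigma> j * max (y \<bullet> x - a j) 0)) = \<mu> f"
proof (induction n)
  case (Suc n)
  have eq: "\<sigma> n * max (y \<bullet> x - a n) 0 = max ((\<sigma> n *\<^sub>R y) \<bullet> x + (- \<sigma> n * a n)) 0" for x
    using \<sigma>[of n] by (simp add: max_mult_distrib_left right_diff_distrib)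
  have "(\<lambda>x. max ((\<sigma> n *\<^sub>R y) \<bullet> x + (- \<sigma> n * a n)) 0) \<in> Conv UNIV"
    by (rule Conv_ridge[OF convex_on_hinge])
  from Conv_add[OF conjunct1[OF Suc.IH] this] hinge[OF conjunct1[OF Suc.IH], of "\<sigma> n *\<^sub>R y" "- \<sigma> n * a n"]
  show ?case using Suc.IH by (simp add: eq add.assoc)
qed (use f in simp)

text \<open>On a bounded range \<open>g\<close> is nearly an affine function plus hinges;
  \<open>\<mu>\<close> ignores the former by affine invariance and the latter by
  \<open>hinge\<close>.\<close>

lemma ridge_invariant:
  assumes \<mu>: "\<mu> \<in> VConv UNIV"
    and hinge: "\<And>f y c. f \<in> Conv UNIV \<Longrightarrow> \<mu> (\<lambda>x. f x + max (y \<bullet> x + c) 0) = \<mu> f"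
    and f: "f \<in> Conv UNIV" and g: "convex_on UNIV (g :: real \<Rightarrow> real)"
  shows "\<mu> (\<lambda>x. f x + g (y \<bullet> x)) = \<mu> f"
proof (rule VConv_limit_unique[OF \<mu> Conv_add[OF f Conv_ridge[OF g]]])
  fix R e :: real assume R: "R > 0" "e > 0"
  \<comment> \<open>By Cauchy-Schwarz this bounds \<open>y \<bullet> x\<close> on the ball; the
    \<open>+ 1\<close> keeps it positive when \<open>y = 0\<close>.\<close>
  then have "(norm y + 1) * R > 0" by (simp add: add_nonneg_pos)
  from convex_piecewise_linear_approx[OF g R(2) this]
  obtain \<alpha> \<beta> and \<sigma> :: "nat \<Rightarrow> real" and a n where \<sigma>: "\<And>j. \<sigma> j \<ge> 0"
    and ap: "\<And>s. s \<in> {-((norm y + 1) * R)..(norm y + 1) * R} \<Longrightarrow>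
      \<bar>\<alpha> + \<beta> * s + (\<Sum>j<n. \<sigma> j * max (s - a j) 0) - g s\<bar> < e"
    by blast
  define F where "F x = f x + (\<Sum>j<n. \<sigma> j * max (y \<bullet> x - a j) 0)" for x
  define G where "G x = F x + ((\<beta> *\<^sub>R y) \<bullet> x + \<alpha>)" for x
  have F: "F \<in> Conv UNIV" "\<mu> F = \<mu> f"
    using hinge_sum_invariant[where \<sigma> = \<sigma> and n = n and y = y and a = a, OF hinge f \<sigma>]
    by (auto simp: F_def[abs_def])
  have "G \<in> Conv UNIV" unfolding G_def[abs_def] by (rule Conv_add[OF F(1) Conv_affine])
  moreover have "\<mu> G = \<mu> f"
    unfolding G_def[abs_def] using VConv_affine_invariant[OF \<mu> F(1)] F(2) by (simp only:)
  moreover have "\<bar>G x - (f x + g (y \<bullet> x))\<bar> < e" if "x \<in> cball 0 R" for x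
  proof -
    have "\<bar>y \<bullet> x\<bar> \<le> norm y * norm x" by (rule Cauchy_Schwarz_ineq2)
    also have "\<dots> \<le> (norm y + 1) * R" using that R by (intro mult_mono) auto
    finally have "y \<bullet> x \<in> {-((norm y + 1) * R)..(norm y + 1) * R}" by auto
    from ap[OF this] show ?thesis by (simp add: G_def F_def algebra_simps)
  qed
  ultimately show "\<exists>G\<in>Conv UNIV. (\<forall>x\<in>cball 0 R. \<bar>G x - (f x + g (y \<bullet> x))\<bar> < e) \<and> \<mu> G = \<mu> f"
    by blast
qed

section \<open>Signed combinations of exponentials\<close>

text \<open>The linear span of exponentials of affine functions, with \<open>r\<close> of either
  sign. Products of such exponentials are again of this kind, so the span is an algebra and admits
  polynomials in its members.\<close>

inductive_set exp_sums :: "('a::euclidean_space \<Rightarrow> real) set" where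
  zero: "(\<lambda>x. 0) \<in> exp_sums"
| add_term: "F \<in> exp_sums \<Longrightarrow> (\<lambda>x. F x + r * exp (y \<bullet> x + b)) \<in> exp_sums"

lemma exp_sums_term: "(\<lambda>x. r * exp (y \<bullet> x + b)) \<in> exp_sums"
  using exp_sums.add_term[OF exp_sums.zero] by simp

lemma exp_sums_const: "(\<lambda>x. r) \<in> exp_sums"
  using exp_sums_term[of r 0 0] by simp

lemma exp_sums_add: "G \<in> exp_sums \<Longrightarrow> F \<in> exp_sums \<Longrightarrow> (\<lambda>x. F x + G x) \<in> exp_sums"
proof (induction rule: exp_sums.induct)
  case (add_term G r y b)
  from exp_sums.add_term[OF add_term.IH[OF add_term.prems]]
  show ?case by (simp add: add.assoc)
qed simp

lemma exp_sums_mult_term: "F \<in> exp_sums \<Longrightarrow> (\<lambda>x. F x * (r * exp (y \<bullet> x + b))) \<in> exp_sums"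
proof (induction rule: exp_sums.induct)
  case (add_term F r' y' b')
  have "(\<lambda>x. F x * (r * exp (y \<bullet> x + b)) + r' * r * exp ((y' + y) \<bullet> x + (b' + b))) \<in> exp_sums"
    by (rule exp_sums.add_term[OF add_term.IH])
  then show ?case by (simp add: algebra_simps exp_add)
qed (simp add: exp_sums.zero)

lemma exp_sums_mult: "G \<in> exp_sums \<Longrightarrow> F \<in> exp_sums \<Longrightarrow> (\<lambda>x. F x * G x) \<in> exp_sums"
proof (induction rule: exp_sums.induct)
  case (add_term G r y b)
  then show ?case
    using exp_sums_add[OF exp_sums_mult_term[OF add_term.prems] add_term.IH[OF add_term.prems]]
    by (simp add: distrib_left)
qed (simp add: exp_sums.zero)

lemma exp_sums_power: "F \<in> exp_sums \<Longrightarrow> (\<lambda>x. F x ^ n) \<in> exp_sums"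
proof (induction n)
  case (Suc n)
  then show ?case using exp_sums_mult[OF Suc.IH[OF Suc.prems] Suc.prems] by simp
qed (simp add: exp_sums_const)

lemma exp_sums_sum:
  "finite I \<Longrightarrow> (\<And>i. i \<in> I \<Longrightarrow> F i \<in> exp_sums) \<Longrightarrow> (\<lambda>x. \<Sum>i\<in>I. F i x) \<in> exp_sums"
proof (induction rule: finite_induct)
  case (insert i I)
  then have "(\<lambda>x. \<Sum>i\<in>I. F i x) \<in> exp_sums" "F i \<in> exp_sums" by simp_all
  from exp_sums_add[OF this] insert.hyps show ?case by simp
qed (simp add: exp_sums_const)

text \<open>Each term is, up to sign, a convex function of one linear form. Positive terms are
  collected in \<open>P\<close> and negated negative ones in \<open>N\<close>, so both are convex
  even if \<open>F\<close> is not.\<close>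

lemma exp_sums_convex_diff:
  assumes \<mu>: "\<mu> \<in> VConv UNIV"
    and hinge: "\<And>f y c. f \<in> Conv UNIV \<Longrightarrow> \<mu> (\<lambda>x. f x + max (y \<bullet> x + c) 0) = \<mu> f"
    and F: "F \<in> exp_sums"
  shows "\<exists>P\<in>Conv UNIV. \<exists>N\<in>Conv UNIV. (\<forall>x. F x + N x = P x) \<and>
    (\<forall>f\<in>Conv UNIV. \<mu> (\<lambda>x. f x + P x) = \<mu> f \<and> \<mu> (\<lambda>x. f x + N x) = \<mu> f)"
  using F
proof (induction rule: exp_sums.induct)
  case zero
  have "(\<lambda>x. 0) \<in> Conv UNIV" by (simp add: Conv_UNIV_iff convex_on_const)
  then show ?case by (intro bexI[of _ "\<lambda>x. 0"]) auto
next
  case (add_term F r y b)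
  then obtain P N where PN: "P \<in> Conv UNIV" "N \<in> Conv UNIV" "\<And>x. F x + N x = P x"
    "\<And>f. f \<in> Conv UNIV \<Longrightarrow> \<mu> (\<lambda>x. f x + P x) = \<mu> f"
    "\<And>f. f \<in> Conv UNIV \<Longrightarrow> \<mu> (\<lambda>x. f x + N x) = \<mu> f"
    by blast
  define T where "T x = \<bar>r\<bar> * exp (y \<bullet> x + b)" for x
  have cv: "convex_on UNIV (\<lambda>s. \<bar>r\<bar> * exp b * exp s)"
    using exp_convex by (intro convex_on_cmul) auto
  have T: "T = (\<lambda>x. \<bar>r\<bar> * exp b * exp (y \<bullet> x))" by (simp add: T_def[abs_def] exp_add mult_ac)
  have Tc: "T \<in> Conv UNIV" unfolding T by (rule Conv_ridge[OF cv])
  have Ti: "\<mu> (\<lambda>x. f x + T x) = \<mu> f" if "f \<in> Conv UNIV" for f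
    unfolding T by (rule ridge_invariant[OF \<mu> hinge that cv])
  have inv: "\<mu> (\<lambda>x. f x + (Q x + T x)) = \<mu> f"
    if "f \<in> Conv UNIV" "Q \<in> Conv UNIV" "\<And>f. f \<in> Conv UNIV \<Longrightarrow> \<mu> (\<lambda>x. f x + Q x) = \<mu> f" for f Q
    using Ti[OF Conv_add[OF that(1,2)]] that by (simp add: add.assoc)
  show ?case
  proof (cases "r \<ge> 0")
    case True
    then have "F x + r * exp (y \<bullet> x + b) + N x = P x + T x" for x
      using PN(3)[of x] by (simp add: T_def)
    then show ?thesis using PN inv Conv_add[OF PN(1) Tc]
      by (intro bexI[of _ "\<lambda>x. P x + T x"] bexI[of _ N]) auto
  next
    case False
    then have "F x + r * exp (y \<bullet> x + b) + (N x + T x) = P x" for x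
      using PN(3)[of x] by (simp add: T_def)
    then show ?thesis using PN inv Conv_add[OF PN(2) Tc]
      by (intro bexI[of _ P] bexI[of _ "\<lambda>x. N x + T x"]) auto
  qed
qed

section \<open>Density of the convex exponential sums\<close>

text \<open>Subtracting the logarithms of the sums at \<open>x\<close> and \<open>z\<close> from the
  exponents normalizes both sums to 1; convexity of \<open>exp\<close>, term by term, then bounds
  the mixed sum by 1.\<close>

lemma convex_on_log_sum_exp:
  fixes y :: "'i \<Rightarrow> 'a::euclidean_space"
  assumes "finite I" "I \<noteq> {}"
  shows "convex_on UNIV (\<lambda>x. ln (\<Sum>i\<in>I. exp (y i \<bullet> x + c i)))"
proof (intro convex_onI)
  fix t :: real and x z :: 'a
  assume t: "0 < t" "t < 1"
  define A where "A x = (\<Sum>i\<in>I. exp (y i \<bullet> x + c i))" for x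
  have A: "A x > 0" for x unfolding A_def using assms by (intro sum_pos) auto
  define w where "w = (1 - t) * ln (A x) + t * ln (A z)"
  have "A ((1 - t) *\<^sub>R x + t *\<^sub>R z) * exp (- w) =
      (\<Sum>i\<in>I. exp ((1 - t) *\<^sub>R (y i \<bullet> x + c i - ln (A x)) + t *\<^sub>R (y i \<bullet> z + c i - ln (A z))))"
    unfolding A_def sum_distrib_right w_def
    by (intro sum.cong refl) (simp add: exp_add[symmetric] inner_add_right algebra_simps)
  also have "\<dots> \<le> (\<Sum>i\<in>I. (1 - t) * exp (y i \<bullet> x + c i - ln (A x)) + t * exp (y i \<bullet> z + c i - ln (A z)))"
    using t by (intro sum_mono convex_onD[OF exp_convex]) auto
  also have "\<dots> = (1 - t) * (A x / A x) + t * (A z / A z)"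
    using A by (simp add: sum.distrib sum_distrib_left[symmetric] sum_divide_distrib[symmetric] exp_diff)
      (simp add: A_def)
  also have "\<dots> = 1" using A[of x] A[of z] by simp
  finally have "A ((1 - t) *\<^sub>R x + t *\<^sub>R z) \<le> exp w"
    by (simp add: exp_minus field_simps)
  then have "ln (A ((1 - t) *\<^sub>R x + t *\<^sub>R z)) \<le> w"
    using A by (metis ln_exp ln_le_cancel_iff exp_gt_zero)
  then show "ln (\<Sum>i\<in>I. exp (y i \<bullet> ((1 - t) *\<^sub>R x + t *\<^sub>R z) + c i))
      \<le> (1 - t) * ln (\<Sum>i\<in>I. exp (y i \<bullet> x + c i)) + t * ln (\<Sum>i\<in>I. exp (y i \<bullet> z + c i))"
    by (simp add: A_def w_def)
qed simp

text \<open>\<open>\<Psi> m s\<close> is the Taylor polynomial of \<open>ln\<close> at \<open>1\<close>, evaluated at \<open>exp s\<close>. Its derivative telescopes to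
  \<open>1 - (1 - exp s) ^ m\<close>, which for odd \<open>m\<close> is nonnegative and increasing on the whole line.\<close>

lemma truncated_log_convex_mono_approx:
  fixes M e :: real
  assumes "M > 0" "e > 0"
  defines "\<Psi> \<equiv> \<lambda>m s. - (\<Sum>j<m. (1 - exp s) ^ Suc j / real (Suc j))"
  shows "\<exists>m. convex_on UNIV (\<Psi> m) \<and> mono (\<Psi> m) \<and> (\<forall>s\<in>{-M..0}. \<bar>\<Psi> m s - s\<bar> < e)"
proof -
  have deriv: "(\<Psi> m has_real_derivative 1 - (1 - exp s) ^ m) (at s)" for m s
  proof -
    have "(\<Psi> m has_real_derivative - (\<Sum>j<m. (1 - exp s) ^ j * (- exp s))) (at s)"
      unfolding \<Psi>_def
      by (rule derivative_eq_intros refl | simp)+ (simp add: field_simps)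
    also have "- (\<Sum>j<m. (1 - exp s) ^ j * (- exp s)) = 1 - (1 - exp s) ^ m"
      using one_diff_power_eq[of "1 - exp s" m]
      by (simp add: sum_distrib_left sum_negf mult.commute)
    finally show ?thesis .
  qed
  define q where "q = 1 - exp (- M)"
  have q: "0 \<le> q" "q < 1" using assms by (auto simp: q_def)
  obtain n where n: "q ^ n < e / M"
    using real_arch_pow_inv[of "e / M" q] q assms by auto
  \<comment> \<open>Odd, for convexity and monotonicity, and at least \<open>n\<close>, so that
    \<open>q ^ m \<le> q ^ n\<close>.\<close>
  define m where "m = Suc (2 * n)"
  have "convex_on UNIV (\<Psi> m)"
    by (rule convex_on_realI[where f' = "\<lambda>s. 1 - (1 - exp s) ^ m"])
      (auto simp: deriv m_def simp del: power_Suc intro!: power_mono_odd)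
  moreover have "(1 - exp s) ^ m \<le> 1" for s :: real
    using power_mono_odd[of m "1 - exp s" 1] by (simp add: m_def)
  then have "mono (\<Psi> m)"
    by (intro monoI DERIV_nonneg_imp_nondecreasing[where f = "\<Psi> m"]) (auto intro: deriv)
  moreover have "\<bar>\<Psi> m s - s\<bar> < e" if s: "s \<in> {-M..0}" for s
  proof -
    \<comment> \<open>The error vanishes at 0, and on \<open>{-M..0}\<close> its derivative is at
      most \<open>q ^ m\<close> in size.\<close>
    have "norm ((\<Psi> m s - s) - (\<Psi> m 0 - 0)) \<le> q ^ m * norm (s - 0)"
    proof (rule field_differentiable_bound[where S = "{-M..0}" and f' = "\<lambda>s. - ((1 - exp s) ^ m)"])
      fix z assume z: "z \<in> {-M..0}"
      show "((\<lambda>s. \<Psi> m s - s) has_field_derivative - ((1 - exp z) ^ m)) (at z within {-M..0})"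
        by (rule DERIV_subset[of _ _ _ UNIV]) (auto intro!: derivative_eq_intros deriv)
      have "(1 - exp z) ^ m \<le> q ^ m" "0 \<le> (1 - exp z) ^ m"
        using z by (auto intro!: power_mono simp: q_def)
      then show "norm (- ((1 - exp z) ^ m)) \<le> q ^ m" by simp
    qed (use s \<open>M > 0\<close> in auto)
    also have "\<dots> \<le> q ^ n * M"
      using q s by (intro mult_mono power_decreasing) (auto simp: m_def)
    also have "\<dots> < e" using n \<open>M > 0\<close> by (simp add: field_simps)
    finally show ?thesis by (simp add: \<Psi>_def)
  qed
  ultimately show ?thesis by blast
qed

text \<open>A hyperplane separating the point \<open>(z, f z - e)\<close> from the closed convex
  epigraph is the graph of the minorant.\<close>

lemma Conv_affine_minorant:
  fixes f :: "'a::euclidean_space \<Rightarrow> real"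
  assumes f: "f \<in> Conv UNIV" and "e > 0"
  shows "\<exists>y c. (\<forall>x. y \<bullet> x + c \<le> f x) \<and> f z - e < y \<bullet> z + c"
proof -
  have "continuous_on UNIV (\<lambda>p :: 'a \<times> real. f (fst p))"
    by (rule continuous_on_compose2[OF Conv_continuous[OF f, of UNIV]
          continuous_on_fst[OF continuous_on_id]]) simp
  then have "closed {p. f (fst p) \<le> snd p}"
    by (rule closed_Collect_le[OF _ continuous_on_snd[OF continuous_on_id]])
  then have cl: "closed (epigraph UNIV f)" by (simp add: epigraph_def)
  have cv: "convex (epigraph UNIV f)" using f by (simp add: Conv_UNIV_iff convex_epigraph)
  have "(z, f z - e) \<notin> epigraph UNIV f" using \<open>e > 0\<close> by (simp add: mem_epigraph)
  then obtain a b where ab: "a \<bullet> (z, f z - e) < b" "\<And>p. p \<in> epigraph UNIV f \<Longrightarrow> a \<bullet> p > b"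
    using separating_hyperplane_closed_point[OF cv cl] by metis
  obtain p q where a: "a = (p, q)" by fastforce
  have above: "p \<bullet> x + q * f x > b" for x
    using ab(2)[of "(x, f x)"] by (simp add: mem_epigraph a)
  have below: "p \<bullet> z + q * (f z - e) < b" using ab(1) by (simp add: a)
  \<comment> \<open>The hyperplane separates two points of the vertical line over \<open>z\<close>,
    so it is not vertical.\<close>
  have "q * e > 0" using above[of z] below by (simp add: algebra_simps)
  then have q: "q > 0" using \<open>e > 0\<close> by (simp add: zero_less_mult_iff)
  have eq: "((- 1 / q) *\<^sub>R p) \<bullet> x + b / q = (b - p \<bullet> x) / q" for x
    by (simp add: diff_divide_distrib)
  show ?thesis
  proof (intro exI conjI allI)
    show "((- 1 / q) *\<^sub>R p) \<bullet> x + b / q \<le> f x" for x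
      unfolding eq using above[of x] q by (simp add: divide_le_eq mult.commute)
    show "f z - e < ((- 1 / q) *\<^sub>R p) \<bullet> z + b / q"
      unfolding eq using below q by (simp add: less_divide_eq mult.commute)
  qed
qed

text \<open>Three approximations are chained: finitely many affine minorants, a scaled log-sum-exp
  in place of their maximum, and a polynomial in place of the logarithm.\<close>

lemma Conv_exp_sums_approx:
  fixes f :: "'a::euclidean_space \<Rightarrow> real"
  assumes f: "f \<in> Conv UNIV" and "R > 0" "e > 0"
  shows "\<exists>F\<in>Conv UNIV \<inter> exp_sums. \<forall>x\<in>cball 0 R. \<bar>F x - f x\<bar> < e"
proof -
  define d where "d = e / 3"
  have d: "d > 0" using \<open>e > 0\<close> by (simp add: d_def)
  have "\<forall>z. \<exists>y c. (\<forall>x. y \<bullet> x + c \<le> f x) \<and> f z - d < y \<bullet> z + c"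
    using Conv_affine_minorant[OF f d] by blast
  then obtain Y C where YC: "\<And>z x. Y z \<bullet> x + C z \<le> f x" "\<And>z. f z - d < Y z \<bullet> z + C z"
    by metis
  \<comment> \<open>By compactness finitely many minorants suffice: at each point of the ball one of
    them is within \<open>d\<close> of \<open>f\<close>.\<close>
  obtain I where I: "finite I" "cball 0 R \<subseteq> (\<Union>z\<in>I. {x. f x - d < Y z \<bullet> x + C z})"
  proof (rule compactE_image[of "cball 0 R" "cball 0 R" "\<lambda>z. {x. f x - d < Y z \<bullet> x + C z}"])
    show "open {x. f x - d < Y z \<bullet> x + C z}" for z
      using Conv_continuous[OF f] by (intro open_Collect_less continuous_intros) auto
    show "cball 0 R \<subseteq> (\<Union>z\<in>cball 0 R. {x. f x - d < Y z \<bullet> x + C z})" using YC(2) by blast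
  qed (use that in auto)
  have "0 \<in> cball (0::'a) R" using \<open>R > 0\<close> by simp
  then have "I \<noteq> {}" using I(2) by blast
  then have card: "card I \<ge> 1" using I(1) by (simp add: Suc_leI card_gt_0_iff)
  \<comment> \<open>Log-sum-exp exceeds the largest exponent by at most \<open>ln (card I)\<close>,
    which is less than \<open>t * d\<close> for this \<open>t\<close>. The \<open>+ 1\<close> keeps
    \<open>t\<close> positive when \<open>card I = 1\<close>.\<close>
  define t where "t = (ln (card I) + 1) / d"
  have t: "t > 0" "ln (card I) < t * d" using d card by (auto simp: t_def add_nonneg_pos)
  define L where "L x = ln (\<Sum>i\<in>I. exp ((t *\<^sub>R Y i) \<bullet> x + t * C i))" for x
  have sum_pos: "(\<Sum>i\<in>I. exp ((t *\<^sub>R Y i) \<bullet> x + t * C i)) > 0" for x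
    using I \<open>I \<noteq> {}\<close> by (intro sum_pos) auto
  have L: "L \<in> Conv UNIV"
    unfolding L_def[abs_def] Conv_UNIV_iff by (rule convex_on_log_sum_exp[OF I(1) \<open>I \<noteq> {}\<close>])
  have upper: "L x < t * (f x + d)" for x
  proof -
    have "(\<Sum>i\<in>I. exp ((t *\<^sub>R Y i) \<bullet> x + t * C i)) \<le> (\<Sum>i\<in>I. exp (t * f x))"
      using YC(1)[of _ x] t by (intro sum_mono) (simp add: distrib_left[symmetric])
    then have "L x \<le> ln (card I * exp (t * f x))"
      unfolding L_def using sum_pos[of x] by (simp only: sum_constant) (simp add: ln_mono)
    also have "\<dots> = ln (card I) + t * f x" using card by (subst ln_mult) auto
    finally show ?thesis using t by (simp add: algebra_simps)
  qed
  have lower: "t * (f x - d) \<le> L x" if x: "x \<in> cball 0 R" for x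
  proof -
    obtain i where i: "i \<in> I" "f x - d < Y i \<bullet> x + C i" using I(2) x by blast
    have "exp (t * (f x - d)) \<le> exp ((t *\<^sub>R Y i) \<bullet> x + t * C i)"
      using i t by (simp add: distrib_left[symmetric])
    also have "\<dots> \<le> (\<Sum>i\<in>I. exp ((t *\<^sub>R Y i) \<bullet> x + t * C i))"
      using i I(1) by (intro member_le_sum) auto
    finally have "ln (exp (t * (f x - d))) \<le> L x"
      unfolding L_def by (rule iffD2[OF ln_le_cancel_iff[OF exp_gt_zero sum_pos]])
    then show ?thesis by simp
  qed
  have "bounded (L ` cball 0 R)"
    by (intro compact_imp_bounded compact_continuous_image Conv_continuous[OF L]) auto
  then obtain B where B: "B > 0" "\<And>x. x \<in> cball 0 R \<Longrightarrow> \<bar>L x\<bar> \<le> B"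
    unfolding bounded_pos by auto
  define \<Psi> where "\<Psi> m s = - (\<Sum>j<m. (1 - exp s) ^ Suc j / real (Suc j))" for m s
  obtain m where m: "convex_on UNIV (\<Psi> m)" "mono (\<Psi> m)"
    "\<And>s. s \<in> {-(2 * B)..0} \<Longrightarrow> \<bar>\<Psi> m s - s\<bar> < t * d"
    using truncated_log_convex_mono_approx[of "2 * B" "t * d"] B t d
    unfolding \<Psi>_def[abs_def] by auto
  \<comment> \<open>On the ball \<open>L x - B\<close> lies in \<open>{-(2 * B)..0}\<close>, where
    \<open>\<Psi> m\<close> is close to the identity; adding \<open>B\<close> and dividing by
    \<open>t\<close> undo the shift and the scaling.\<close>
  define F where "F x = (1 / t) * (B + \<Psi> m (L x - B))" for x
  have "F \<in> Conv UNIV"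
  proof -
    have "convex_on UNIV (\<lambda>x. \<Psi> m (L x - B))"
    proof (intro convex_onI)
      fix r :: real and x z :: 'a assume r: "0 < r" "r < 1"
      have "L ((1 - r) *\<^sub>R x + r *\<^sub>R z) \<le> (1 - r) * L x + r * L z"
        using L r by (intro convex_onD) (auto simp: Conv_UNIV_iff)
      then have "L ((1 - r) *\<^sub>R x + r *\<^sub>R z) - B \<le> (1 - r) *\<^sub>R (L x - B) + r *\<^sub>R (L z - B)"
        by (simp add: algebra_simps)
      \<comment> \<open>Monotonicity on the whole line matters here, since \<open>L - B\<close> may
        leave that interval outside the ball.\<close>
      then have "\<Psi> m (L ((1 - r) *\<^sub>R x + r *\<^sub>R z) - B)
          \<le> \<Psi> m ((1 - r) *\<^sub>R (L x - B) + r *\<^sub>R (L z - B))"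
        by (rule monoD[OF m(2)])
      also have "\<dots> \<le> (1 - r) * \<Psi> m (L x - B) + r * \<Psi> m (L z - B)"
        using m(1) r by (intro convex_onD) auto
      finally show "\<Psi> m (L ((1 - r) *\<^sub>R x + r *\<^sub>R z) - B)
          \<le> (1 - r) * \<Psi> m (L x - B) + r * \<Psi> m (L z - B)" .
    qed simp
    then have "convex_on UNIV (\<lambda>x. B + \<Psi> m (L x - B))"
      by (intro convex_on_add) (simp_all add: convex_on_const)
    then have "convex_on UNIV (\<lambda>x. (1 / t) * (B + \<Psi> m (L x - B)))"
      using t by (intro convex_on_cmul) auto
    then show ?thesis by (simp add: F_def[abs_def] Conv_UNIV_iff)
  qed
  moreover have "F \<in> exp_sums"
  proof -
    \<comment> \<open>\<open>exp\<close> undoes the logarithm in \<open>L\<close>, so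
      \<open>\<Psi> m (L x - B)\<close> is a polynomial in a sum of exponentials.\<close>
    have "exp (L x - B) = (\<Sum>i\<in>I. 1 * exp ((t *\<^sub>R Y i) \<bullet> x + (t * C i - B)))" for x
      using sum_pos[of x] by (simp add: L_def exp_diff sum_divide_distrib exp_add)
    then have eq: "F = (\<lambda>x. (1 / t) * (B + (- 1) * (\<Sum>j<m. (1 / real (Suc j)) *
        (1 + (- 1) * (\<Sum>i\<in>I. 1 * exp ((t *\<^sub>R Y i) \<bullet> x + (t * C i - B)))) ^ Suc j)))"
      by (simp add: F_def[abs_def] \<Psi>_def)
    show ?thesis
      unfolding eq
      by (intro exp_sums_mult exp_sums_add exp_sums_sum exp_sums_power exp_sums_const
          exp_sums_term I(1) finite_lessThan)
  qed
  moreover have "\<bar>F x - f x\<bar> < e" if x: "x \<in> cball 0 R" for x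
  proof -
    have "\<bar>\<Psi> m (L x - B) - (L x - B)\<bar> < t * d" using B(2)[OF x] by (intro m(3)) auto
    then have "\<bar>t * F x - L x\<bar> < t * d" using t by (simp add: F_def)
    then have "\<bar>t * F x - t * f x\<bar> < t * (3 * d)"
      using upper[of x] lower[OF x] by (simp add: algebra_simps abs_less_iff) 
    then have "t * \<bar>F x - f x\<bar> < t * (3 * d)"
      using t by (simp add: right_diff_distrib[symmetric] abs_mult)
    then show ?thesis using t by (simp add: d_def)
  qed
  ultimately show ?thesis by blast
qed

section \<open>Vanishing by induction on the degree\<close>

lemma hinge_invariant_imp_constant:
  assumes \<mu>: "\<mu> \<in> VConv UNIV"
    and hinge: "\<And>f y c. f \<in> Conv UNIV \<Longrightarrow> \<mu> (\<lambda>x. f x + max (y \<bullet> x + c) 0) = \<mu> f"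
    and f: "f \<in> Conv UNIV"
  shows "\<mu> f = \<mu> (\<lambda>x. 0)"
proof (rule VConv_limit_unique[OF \<mu> f])
  have zero: "(\<lambda>x. 0) \<in> Conv UNIV" by (simp add: Conv_UNIV_iff convex_on_const)
  have "\<mu> F = \<mu> (\<lambda>x. 0)" if F: "F \<in> Conv UNIV" "F \<in> exp_sums" for F
  proof -
    obtain P N where PN: "\<And>x. F x + N x = P x"
      "\<And>f. f \<in> Conv UNIV \<Longrightarrow> \<mu> (\<lambda>x. f x + P x) = \<mu> f \<and> \<mu> (\<lambda>x. f x + N x) = \<mu> f"
      using exp_sums_convex_diff[OF \<mu> hinge F(2)] by blast
    \<comment> \<open>\<open>F + N\<close> and \<open>0 + P\<close> are the same function, and
      adding \<open>N\<close> or \<open>P\<close> does not change \<open>\<mu>\<close>.\<close>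
    have "\<mu> F = \<mu> (\<lambda>x. F x + N x)" using PN(2)[OF F(1)] by simp
    also have "\<dots> = \<mu> (\<lambda>x. 0 + P x)" by (simp add: PN(1))
    also have "\<dots> = \<mu> (\<lambda>x. 0)" using PN(2)[OF zero] by simp
    finally show ?thesis .
  qed
  then show "\<exists>g\<in>Conv UNIV. (\<forall>x\<in>cball 0 R. \<bar>g x - f x\<bar> < e) \<and> \<mu> g = \<mu> (\<lambda>x. 0)"
    if "R > 0" "e > 0" for R e
    using Conv_exp_sums_approx[OF f that] by blast
qed

text \<open>Asking for homogeneity under halving only, the inductive step needs no more than
  \<open>VConv_add_hinge_twice\<close> instead of linearity in \<open>s\<close> of \<open>\<mu> (f + s \<l>\<^sub>+) - \<mu> f\<close>.\<close>

lemma low_rank_vanishing_imp_zero: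
  fixes \<mu> :: "('a::euclidean_space \<Rightarrow> real) \<Rightarrow> real"
  assumes "\<mu> \<in> VConv UNIV"
    and "\<And>f. f \<in> Conv UNIV \<Longrightarrow> \<mu> (\<lambda>x. (1/2) * f x) = (1/2) ^ k * \<mu> f"
    and "\<And>f B. f \<in> Conv UNIV \<Longrightarrow> finite B \<Longrightarrow> card B \<le> k \<Longrightarrow>
      (\<And>x z. (\<And>b. b \<in> B \<Longrightarrow> b \<bullet> z = 0) \<Longrightarrow> f (x + z) = f x) \<Longrightarrow> \<mu> f = 0"
    and "f \<in> Conv UNIV"
  shows "\<mu> f = 0"
  using assms
proof (induction k arbitrary: \<mu> f)
  case (0 \<mu> f)
  note \<mu> = "0.prems"(1) and half = "0.prems"(2) and f = "0.prems"(4)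
  have zero: "(\<lambda>x. 0) \<in> Conv UNIV" by (simp add: Conv_UNIV_iff convex_on_const)
  have pow: "(\<lambda>x. (1/2) ^ m * f x) \<in> Conv UNIV" for m
    by (rule Conv_cmult[OF f]) simp
  have eq: "\<mu> (\<lambda>x. (1/2) ^ m * f x) = \<mu> f" for m
  proof (induction m)
    case (Suc m)
    then show ?case using half[OF pow[of m]] by (simp add: mult.assoc)
  qed simp
  \<comment> \<open>In degree 0 repeated halving fixes \<open>\<mu>\<close>, while the halved
    functions tend to 0 uniformly on balls.\<close>
  have "\<mu> (\<lambda>x. 0) = \<mu> f"
  proof (rule VConv_limit_unique[OF \<mu> zero])
    fix R e :: real assume "R > 0" "e > 0"
    have "bounded (f ` cball 0 R)"
      by (intro compact_imp_bounded compact_continuous_image Conv_continuous[OF f]) auto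
    then obtain B where B: "B > 0" "\<And>x. x \<in> cball 0 R \<Longrightarrow> \<bar>f x\<bar> \<le> B"
      unfolding bounded_pos by auto
    obtain m where m: "(1/2) ^ m < e / B"
      using real_arch_pow_inv[of "e / B" "1/2"] \<open>e > 0\<close> B(1) by auto
    have "\<bar>(1/2) ^ m * f x - 0\<bar> < e" if "x \<in> cball 0 R" for x
    proof -
      have "\<bar>(1/2) ^ m * f x - 0\<bar> \<le> (1/2) ^ m * B"
        using B(2)[OF that] by (simp add: abs_mult power_abs)
      also have "\<dots> < e" using m B(1) by (simp add: less_divide_eq)
      finally show ?thesis .
    qed
    then show "\<exists>g\<in>Conv UNIV. (\<forall>x\<in>cball 0 R. \<bar>g x - 0\<bar> < e) \<and> \<mu> g = \<mu> f"
      using pow[of m] eq[of m] by (intro bexI[of _ "\<lambda>x. (1/2) ^ m * f x"]) auto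
  qed
  moreover have "\<mu> (\<lambda>x. 0) = 0"
    by (rule "0.prems"(3)[OF zero, of "{}"]) auto
  ultimately show ?case by simp
next
  case (Suc k \<mu> f)
  note \<mu> = Suc.prems(1) and half = Suc.prems(2) and low = Suc.prems(3)
  have hinge: "\<mu> (\<lambda>x. h x + max (y \<bullet> x + c) 0) = \<mu> h" if h: "h \<in> Conv UNIV" for h y c
  proof -
    define p where "p x = max (y \<bullet> x + c) 0" for x
    have p: "p \<in> Conv UNIV" unfolding p_def[abs_def] by (rule Conv_ridge[OF convex_on_hinge])
    have "\<mu> (\<lambda>x. h x + p x) - \<mu> h = 0"
    proof (rule Suc.IH[of "\<lambda>f. \<mu> (\<lambda>x. f x + p x) - \<mu> f"])
      show "(\<lambda>f. \<mu> (\<lambda>x. f x + p x) - \<mu> f) \<in> VConv UNIV" by (rule VConv_difference[OF \<mu> p])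
      fix f :: "'a \<Rightarrow> real" assume f: "f \<in> Conv UNIV"
      \<comment> \<open>\<open>f / 2 + p\<close> is half of \<open>f + 2 p\<close>, so
        \<open>half\<close> applies; the factor 2 gained from the hinge identity then lowers the
        degree from \<open>Suc k\<close> to \<open>k\<close>.\<close>
      have "(\<lambda>x. f x + 2 * p x) \<in> Conv UNIV" by (rule Conv_add[OF f Conv_cmult[OF p]]) simp
      from half[OF this] have 1: "\<mu> (\<lambda>x. (1/2) * f x + p x) = (1/2) ^ Suc k * \<mu> (\<lambda>x. f x + 2 * p x)"
        by (simp add: distrib_left)
      have 2: "\<mu> (\<lambda>x. f x + 2 * p x) - \<mu> f = 2 * (\<mu> (\<lambda>x. f x + p x) - \<mu> f)"
        using VConv_add_hinge_twice[OF \<mu> f, of y c] by (simp add: p_def)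
      show "\<mu> (\<lambda>x. (1/2) * f x + p x) - \<mu> (\<lambda>x. (1/2) * f x)
          = (1/2) ^ k * (\<mu> (\<lambda>x. f x + p x) - \<mu> f)"
        unfolding 1 half[OF f] right_diff_distrib[symmetric] 2 power_Suc
        by simp
    next
      fix f :: "'a \<Rightarrow> real" and B
      assume f: "f \<in> Conv UNIV" and B: "finite B" "card B \<le> k"
        and inv: "\<And>x z. (\<And>b. b \<in> B \<Longrightarrow> b \<bullet> z = 0) \<Longrightarrow> f (x + z) = f x"
      \<comment> \<open>Adding \<open>p\<close> costs one further direction, namely
        \<open>y\<close>.\<close>
      have "card (insert y B) \<le> Suc k" using B by (simp add: card_insert_if)
      moreover have "f (x + z) + p (x + z) = f x + p x"
        if "\<And>b. b \<in> insert y B \<Longrightarrow> b \<bullet> z = 0" for x z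
        using inv[of z x] that by (simp add: p_def inner_add_right)
      ultimately have "\<mu> (\<lambda>x. f x + p x) = 0"
        using low[OF Conv_add[OF f p], of "insert y B"] B(1) by blast
      moreover have "\<mu> f = 0"
        using low[OF f B(1) _ inv] B(2) by simp
      ultimately show "\<mu> (\<lambda>x. f x + p x) - \<mu> f = 0" by simp
    qed (rule h)
    then show ?thesis by (simp add: p_def)
  qed
  have zero: "(\<lambda>x. 0) \<in> Conv UNIV" by (simp add: Conv_UNIV_iff convex_on_const)
  have "\<mu> f = \<mu> (\<lambda>x. 0)" by (rule hinge_invariant_imp_constant[OF \<mu> hinge Suc.prems(4)])
  also have "\<dots> = 0" by (rule low[OF zero, of "{}"]) auto
  finally show ?case .
qed

section \<open>Reduction to subspaces of dimension k\<close>

text \<open>At most \<open>k\<close> directions may span too little, whereas the projections are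
  known to vanish in dimension exactly \<open>k\<close>; the span is enlarged one vector at a
  time.\<close>

lemma subspace_extend_dim:
  fixes S :: "'a::euclidean_space set"
  assumes "dim S \<le> k" "k \<le> DIM('a)"
  shows "\<exists>T. subspace T \<and> S \<subseteq> T \<and> dim T = k"
  using assms
proof (induction k rule: dec_induct)
  case base
  show ?case by (intro exI[of _ "span S"]) (auto intro: span_base)
next
  case (step n)
  then obtain T where T: "subspace T" "S \<subseteq> T" "dim T = n" by auto
  then have "T \<noteq> UNIV" using step.prems by auto
  then obtain x where "x \<notin> span T" using T(1) by (metis UNIV_eq_I span_eq_iff)
  then have "dim (span (insert x T)) = Suc n" using T(3) by (simp add: dim_insert)
  moreover have "S \<subseteq> span (insert x T)" using T(2) by (auto intro: span_base)
  ultimately show ?case by (intro exI[of _ "span (insert x T)"]) simp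
qed

theorem theorem3:
  fixes \<mu> :: "(real ^ 'n \<Rightarrow> real) \<Rightarrow> real" and k :: nat
  assumes "k \<le> CARD('n)"
    and "\<mu> \<in> VConv_hom UNIV k"
    and "\<And>E :: (real ^ 'n) set. subspace E \<Longrightarrow> dim E = k \<Longrightarrow>
           \<forall>f\<in>Conv E. pushforward_proj E \<mu> f = 0"
  shows "\<forall>f\<in>Conv UNIV. \<mu> f = 0"
proof -
  have \<mu>: "\<mu> \<in> VConv UNIV" using assms(2) by (simp add: VConv_hom_def)
  have half: "\<mu> (\<lambda>x. (1/2) * f x) = (1/2) ^ k * \<mu> f" if "f \<in> Conv UNIV" for f
    using assms(2) that unfolding VConv_hom_def by (simp del: times_divide_eq_left)
  \<comment> \<open>A function unchanged by translations orthogonal to \<open>B\<close> factors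
    through the orthogonal projection onto any subspace containing \<open>B\<close>.\<close>
  have low: "\<mu> f = 0"
    if f: "f \<in> Conv UNIV" and B: "finite B" "card B \<le> k"
      and inv: "\<And>x z. (\<And>b. b \<in> B \<Longrightarrow> b \<bullet> z = 0) \<Longrightarrow> f (x + z) = f x" for f B
  proof -
    have "dim B \<le> k" using dim_le_card'[OF B(1)] B(2) by linarith
    then obtain E where E: "subspace E" "B \<subseteq> E" "dim E = k"
      using subspace_extend_dim[of B k] assms(1) by auto
    have "f (orth_proj E x) = f x" for x
    proof -
      have "b \<bullet> (x - orth_proj E x) = 0" if "b \<in> B" for b
        using orth_proj(2)[OF E(1), of b x] E(2) that by (auto simp: orthogonal_def inner_commute)
      from inv[OF this, of "orth_proj E x"] show ?thesis by simp
    qed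
    then have "\<mu> f = pushforward_proj E \<mu> f" by (simp add: pushforward_proj_def o_def)
    moreover have "f \<in> Conv E"
      using f E(1) unfolding Conv_def by (auto intro: convex_on_subset subspace_imp_convex)
    ultimately show "\<mu> f = 0" using assms(3)[OF E(1,3)] by simp
  qed
  show ?thesis
  proof
    fix f :: "real ^ 'n \<Rightarrow> real" assume f: "f \<in> Conv UNIV"
    show "\<mu> f = 0"
    proof (rule low_rank_vanishing_imp_zero[OF \<mu> _ _ f])
      show "\<mu> (\<lambda>x. (1/2) * g x) = (1/2) ^ k * \<mu> g" if "g \<in> Conv UNIV" for g
        by (rule half[OF that])
      show "\<mu> g = 0" if "g \<in> Conv UNIV" "finite B" "card B \<le> k"
        "\<And>x z. (\<And>b. b \<in> B \<Longrightarrow> b \<bullet> z = 0) \<Longrightarrow> g (x + z) = g x" for g B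
        by (rule low[OF that])
    qed
  qed
qed

end
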